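(* Let $k\ge 1$ and $1\le r\le 2^k$. Given an instance of random $(k,r)$-QSAT with Hamiltonian $H$ over a $k$-uniform hypergraph $G$ with $N$ qubits (vertices) and $M$ clauses (edges), the degeneracy of zero energy states $D=\dim(\ker(H))$ satisfies $$D\le 2^N\left(1-\frac{r}{2^k}\right)^M$$ with probability $1$ with respect to the random choice of projectors.
   Context: Each vertex of $G$ carries a qubit $\mathbb{C}^2$, and the full Hilbert space is $(\mathbb{C}^2)^{\otimes N}$. Each edge (clause) $I_m$, $m=1,\dots,M$, is a set of $k$ distinct vertices. For each edge an $r$-dimensional subspace of the $2^k$-dimensional Hilbert space of the $k$ qubits in $I_m$ is chosen, independently for different $m$ and uniformly (i.e. with respect to the unitarily invariant Haar measure on the complex Grassmannian $\mathrm{Gr}(r,2^k)$). $\Pi_m$ denotes the orthogonal projector onto this subspace, tensored with the identity on the remaining qubits. An instance of random $(k,r)$-QSAT over $G$ is the random operator $H=\sum_{m=1}^M\Pi_m$ on $(\mathbb{C}^2)^{\otimes N}$. *)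

theory Defs
  imports "HOL-Probability.Probability"
begin

section \<open>Subspaces and orthogonal projectors in \<open>\<complex>\<^sup>n\<close>\<close>

text \<open>The space \<open>\<complex>\<^sup>n\<close> is \<^typ>\<open>complex ^ 'n\<close>, with complex-linear notions taken from the library
  interpretation \<open>vec\<close>; the unprefixed \<open>subspace\<close> and \<open>dim\<close> would be the real-linear ones.\<close>

definition hadjoint :: "complex ^ 'n ^ 'm \<Rightarrow> complex ^ 'm ^ 'n" where
  "hadjoint A = (\<chi> i j. cnj (A $ j $ i))"

definition unitary :: "complex ^ 'n ^ 'n \<Rightarrow> bool" where
  "unitary U \<longleftrightarrow> hadjoint U ** U = mat 1 \<and> U ** hadjoint U = mat 1"

definition orth_proj :: "(complex ^ 'n) set \<Rightarrow> complex ^ 'n ^ 'n" where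
  "orth_proj S = (THE P. P ** P = P \<and> hadjoint P = P \<and> range ((*v) P) = S)"

definition matrix_kernel :: "complex ^ 'n ^ 'm \<Rightarrow> (complex ^ 'n) set" where
  "matrix_kernel A = {x. A *v x = 0}"


section \<open>The complex Grassmannian and its uniform distribution\<close>

definition Gr :: "nat \<Rightarrow> (complex ^ 'n) set set" where
  "Gr r = {S. vec.subspace S \<and> vec.dim S = r}"

text \<open>The usual topology of the Grassmannian is the one making \<^const>\<open>orth_proj\<close> an embedding into
  the matrices, so its Borel sets are the preimages of the Borel sets of matrices.
  Only the space and the sigma-algebra of \<open>Gr_borel r\<close> are used, not its measure.\<close>

definition Gr_borel :: "nat \<Rightarrow> (complex ^ 'n) set measure" where
  "Gr_borel r = vimage_algebra (Gr r) orth_proj borel"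

text \<open>The Haar measure on the Grassmannian, characterised as the Borel probability measure that is
  invariant under the action of the unitary group on subspaces.\<close>

definition is_Haar_Gr :: "nat \<Rightarrow> (complex ^ 'n) set measure \<Rightarrow> bool" where
  "is_Haar_Gr r \<mu> \<longleftrightarrow>
     prob_space \<mu> \<and> sets \<mu> = sets (Gr_borel r) \<and>
     (\<forall>U. unitary U \<longrightarrow> distr \<mu> (Gr_borel r) (\<lambda>S. (*v) U ` S) = \<mu>)"


section \<open>Random \<open>(k,r)\<close>-QSAT\<close>

text \<open>The Hilbert space of qubits labelled by a finite type \<open>'v\<close> is
  \<^typ>\<open>complex ^ ('v \<Rightarrow> bool)\<close>: coordinates with respect to the computational (product) basis, whose
  elements are the assignments \<^typ>\<open>'v \<Rightarrow> bool\<close>.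

  An injection \<open>e :: 'k \<Rightarrow> 'v\<close> identifies the qubits \<open>range e\<close> with \<open>'k\<close>. The operator
  \<open>on_qubits e A\<close> is \<open>A\<close> acting on the qubits in \<open>range e\<close>, tensored with the identity on the
  remaining ones.\<close>

definition on_qubits ::
  "('k::finite \<Rightarrow> 'v::finite) \<Rightarrow> complex ^ ('k \<Rightarrow> bool) ^ ('k \<Rightarrow> bool) \<Rightarrow> complex ^ ('v \<Rightarrow> bool) ^ ('v \<Rightarrow> bool)" where
  "on_qubits e A =
     (\<chi> s t. if \<forall>v. v \<notin> range e \<longrightarrow> s v = t v then A $ (s \<circ> e) $ (t \<circ> e) else 0)"

text \<open>A \<open>k\<close>-uniform hypergraph with edges \<open>I 1, \<dots>, I M\<close>. The Hilbert space of the qubits in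
  \<open>I m\<close> is written in coordinates through an enumeration \<open>e m\<close> of \<open>I m\<close> by a type with \<open>k\<close>
  elements. The enumeration is arbitrary: reordering the qubits is a unitary, which
  does not change the Haar measure.\<close>

definition uniform_hypergraph :: "nat \<Rightarrow> nat \<Rightarrow> (nat \<Rightarrow> 'v set) \<Rightarrow> bool" where
  "uniform_hypergraph k M I \<longleftrightarrow> (\<forall>m\<in>{1..M}. finite (I m) \<and> card (I m) = k)"

definition edge_enumeration :: "nat \<Rightarrow> (nat \<Rightarrow> 'v set) \<Rightarrow> (nat \<Rightarrow> 'k \<Rightarrow> 'v) \<Rightarrow> bool" where
  "edge_enumeration M I e \<longleftrightarrow> (\<forall>m\<in>{1..M}. bij_betw (e m) UNIV (I m))"

text \<open>\<open>W m \<omega>\<close> is the subspace chosen for the edge \<open>m\<close> at the outcome \<open>\<omega>\<close> of the probability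
  space \<open>P\<close>.\<close>

definition random_qsat ::
  "'w measure \<Rightarrow> nat \<Rightarrow> nat \<Rightarrow> (nat \<Rightarrow> 'w \<Rightarrow> (complex ^ ('k::finite \<Rightarrow> bool)) set) \<Rightarrow> bool" where
  "random_qsat P r M W \<longleftrightarrow>
     prob_space P \<and>
     prob_space.indep_vars P (\<lambda>_. Gr_borel r) W {1..M} \<and>
     (\<forall>m\<in>{1..M}. is_Haar_Gr r (distr P (Gr_borel r) (W m)))"

definition qsat_hamiltonian ::
  "nat \<Rightarrow> (nat \<Rightarrow> 'k::finite \<Rightarrow> 'v::finite) \<Rightarrow> (nat \<Rightarrow> (complex ^ ('k \<Rightarrow> bool)) set)
     \<Rightarrow> complex ^ ('v \<Rightarrow> bool) ^ ('v \<Rightarrow> bool)" where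
  "qsat_hamiltonian M e S = (\<Sum>m\<in>{1..M}. on_qubits (e m) (orth_proj (S m)))"

end

theory Submission
  imports Defs
begin

text \<open>Only one edge at a time matters: conditionally on the kernel \<open>V\<close> of the first clauses, a
  random projector \<open>\<Pi>\<close> on \<open>k\<close> qubits a.s. cuts \<open>V\<close> down to dimension at most
  \<open>(1 - r / 2\<^sup>k) dim V\<close>.

  Conjugating \<open>\<Pi>\<close> with all products of bit flips and diagonal sign matrices averages
  it to \<open>r / 2\<^sup>k\<close> times the identity. Since \<open>tr (Q \<Pi>) \<le> dim V - dim (V \<inter> ker \<Pi>)\<close> for the
  projector \<open>Q\<close> onto \<open>V\<close>, at least one of the conjugates satisfies the bound.

  It remains to see that for each Hermitian involution \<open>g\<close>, a.s. \<open>\<Pi>\<close> itself does not leave a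
  larger kernel than \<open>g \<Pi> g\<close>. Along the unitary curve
  \<open>(1 + \<i> x g) / sqrt (1 + x\<^sup>2)\<close> the kernel dimension is minimal except at the finitely many
  zeros of a polynomial in \<open>x\<close>. So each point is moved into the exceptional set by only
  finitely many of the unitaries \<open>x = 1, 2, \<dots>\<close>; these preserve the Haar measure, so the
  exceptional set is null.\<close>

section \<open>Adjoints and kernels\<close>

lemma hadjoint_mult: "hadjoint (A ** B) = hadjoint B ** hadjoint A"
  by (simp add: hadjoint_def matrix_matrix_mult_def vec_eq_iff mult.commute)

lemma hadjoint_hadjoint [simp]: "hadjoint (hadjoint A) = A"
  by (simp add: hadjoint_def vec_eq_iff)

lemma hadjoint_add: "hadjoint (A + B) = hadjoint A + hadjoint B"
  by (simp add: hadjoint_def vec_eq_iff)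

lemma hadjoint_diff: "hadjoint (A - B) = hadjoint A - hadjoint B"
  by (simp add: hadjoint_def vec_eq_iff)

lemma hadjoint_mat [simp]: "hadjoint (mat c) = mat (cnj c)"
  by (simp add: hadjoint_def vec_eq_iff mat_def)

text \<open>The product \<open>\<bullet>\<close> is the real part of the Hermitian one, so a factor
  \<open>a\<close> crosses it as \<open>cnj a\<close>. The orthogonality arguments below run on this
  real product.\<close>

lemma inner_complex_mult_right: "x \<bullet> (a * y) = (cnj a * x) \<bullet> (y::complex)"
  by (simp add: inner_complex_def algebra_simps)

lemma inner_hadjoint: "x \<bullet> (A *v y) = (hadjoint A *v x) \<bullet> y"
proof -
  have "x \<bullet> (A *v y) = (\<Sum>i\<in>UNIV. \<Sum>j\<in>UNIV. (cnj (A$i$j) * x$i) \<bullet> (y$j))"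
    by (simp add: inner_vec_def matrix_vector_mult_def inner_sum_right inner_complex_mult_right)
  also have "\<dots> = (\<Sum>j\<in>UNIV. \<Sum>i\<in>UNIV. (cnj (A$i$j) * x$i) \<bullet> (y$j))"
    by (rule sum.swap)
  also have "\<dots> = (hadjoint A *v x) \<bullet> y"
    by (simp add: inner_vec_def matrix_vector_mult_def inner_sum_left hadjoint_def)
  finally show ?thesis .
qed

lemma matrix_eq_inner: "A = B \<longleftrightarrow> (\<forall>x y. (A *v x) \<bullet> y = (B *v x) \<bullet> y)" for A B :: "complex ^ 'n ^ 'm"
proof
  assume *: "\<forall>x y. (A *v x) \<bullet> y = (B *v x) \<bullet> y"
  have "A *v x = B *v x" for x
    using * by (metis vector_eq_rdot)
  then show "A = B"
    by (simp add: matrix_eq)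
qed simp

text \<open>Moving \<open>A\<close> across the inner product turns
  \<open>hadjoint A *v (A *v x) = 0\<close> into a vanishing squared norm of \<open>A *v x\<close>.
  Any matrix can thus be replaced by a Hermitian one with the same kernel.\<close>

lemma matrix_kernel_hadjoint_mult: "matrix_kernel (hadjoint A ** A) = matrix_kernel A"
proof -
  have "A *v x = 0" if "hadjoint A *v (A *v x) = 0" for x
    using inner_hadjoint[of "A *v x" A x] that by simp
  then show ?thesis
    by (auto simp: matrix_kernel_def simp flip: matrix_vector_mul_assoc)
qed

lemma subspace_matrix_kernel: "vec.subspace (matrix_kernel A)"
  by (simp add: vec.subspace_def matrix_kernel_def matrix_vector_right_distrib vec.scale)

lemma subspace_range_matrix: "vec.subspace (range ((*v) A))"
  by (rule vec.subspace_image) simp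

section \<open>Orthogonal projectors\<close>

text \<open>The predicate under the description operator of \<open>orth_proj\<close>, usable before
  existence and uniqueness are known.\<close>

definition is_orth_proj :: "complex ^ 'n ^ 'n \<Rightarrow> (complex ^ 'n) set \<Rightarrow> bool" where
  "is_orth_proj P S \<longleftrightarrow> P ** P = P \<and> hadjoint P = P \<and> range ((*v) P) = S"

lemma is_orth_proj_fixes: "is_orth_proj P S \<Longrightarrow> x \<in> S \<Longrightarrow> P *v x = x"
  by (auto simp: is_orth_proj_def matrix_vector_mul_assoc)

text \<open>Each projector fixes the range of the other, so \<open>P ** Q = Q\<close> and
  \<open>Q ** P = P\<close>; the adjoint of the first equation reads
  \<open>Q ** P = Q\<close>.\<close>

lemma is_orth_proj_unique:
  assumes P: "is_orth_proj P S" and Q: "is_orth_proj Q S"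
  shows "P = Q"
proof -
  have "P ** Q = Q" if P: "is_orth_proj P S" and Q: "is_orth_proj Q S" for P Q
  proof -
    have "P *v (Q *v x) = Q *v x" for x
      using Q by (intro is_orth_proj_fixes[OF P]) (auto simp: is_orth_proj_def)
    then show ?thesis
      by (simp add: matrix_eq matrix_vector_mul_assoc)
  qed
  then have "P ** Q = Q" "Q ** P = P"
    using P Q by blast+
  then show ?thesis
    using P Q by (metis hadjoint_mult is_orth_proj_def)
qed

text \<open>A complex subspace is also a real one, so the real orthogonal decomposition supplies a
  point \<open>p x\<close> of \<open>S\<close>. Its uniqueness makes \<open>p\<close> linear, and
  the matrix of \<open>p\<close> is the projector.\<close>

lemma is_orth_proj_exists:
  fixes S :: "(complex ^ 'n) set"
  assumes S: "vec.subspace S"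
  shows "\<exists>P. is_orth_proj P S"
proof -
  have "r *\<^sub>R x = of_real r *s x" for r and x :: "complex ^ 'n"
    by (simp add: vec_eq_iff scaleR_conv_of_real[where 'a=complex])
  then have "subspace S"
    using S by (auto simp: vec.subspace_def subspace_def)
  then have span: "span S = S"
    by (simp add: span_eq_iff)
  have "\<exists>y. y \<in> S \<and> (\<forall>w\<in>S. (x - y) \<bullet> w = 0)" for x
    by (rule orthogonal_subspace_decomp_exists[of S x, unfolded span])
       (auto simp: orthogonal_def)
  then obtain p where pS: "p x \<in> S" and pO: "\<And>w. w \<in> S \<Longrightarrow> (x - p x) \<bullet> w = 0" for x
    by metis
  have uniq: "p x = y" if "y \<in> S" "\<And>w. w \<in> S \<Longrightarrow> (x - y) \<bullet> w = 0" for x y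
  proof -
    have d: "p x - y \<in> S"
      using pS that(1) S by (simp add: vec.subspace_diff)
    have "(p x - y) \<bullet> (p x - y) = (x - y) \<bullet> (p x - y) - (x - p x) \<bullet> (p x - y)"
      by (simp add: inner_diff_left)
    then show ?thesis
      using that(2)[OF d] pO[OF d] by simp
  qed
  have smult: "(c *s z) \<bullet> w = z \<bullet> (cnj c *s w)" for c and z w :: "complex ^ 'n"
    by (simp add: inner_vec_def inner_complex_mult_right)
  have lin: "Vector_Spaces.linear (*s) (*s) p"
  proof (unfold_locales, goal_cases)
    case (1 x y)
    have "(x + y - (p x + p y)) \<bullet> w = 0" if "w \<in> S" for w
      using pO[OF that, of x] pO[OF that, of y] by (simp add: algebra_simps)
    then show ?case
      by (intro uniq) (auto simp: pS S vec.subspace_add)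
  next
    case (2 c x)
    \<comment> \<open>Real orthogonality to all of \<open>S\<close> suffices for complex scalars:
      \<open>c\<close> moves onto \<open>w\<close> as \<open>cnj c\<close>, and
      \<open>cnj c *s w\<close> is again in \<open>S\<close>.\<close>
    have "(c *s x - c *s p x) \<bullet> w = 0" if "w \<in> S" for w
      unfolding vec.scale_right_diff_distrib[symmetric] smult
      by (rule pO) (rule vec.subspace_scale[OF S that])
    then show ?case
      by (intro uniq) (auto simp: pS S vec.subspace_scale)
  qed
  define P where "P = matrix p"
  have P: "P *v x = p x" for x
    unfolding P_def by (rule matrix_works[OF lin])
  have pfix: "p x = x" if "x \<in> S" for x
    by (rule uniq) (use that in auto)
  have "P ** P = P"
    by (simp add: matrix_eq P pS pfix flip: matrix_vector_mul_assoc)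
  moreover have "hadjoint P = P"
  proof -
    have "x \<bullet> p y = p x \<bullet> y" for x y
      using pO[OF pS[of y], of x] pO[OF pS[of x], of y] by (metis eq_iff_diff_eq_0 inner_commute inner_diff_left)
    then have "(hadjoint P *v x) \<bullet> y = (P *v x) \<bullet> y" for x y
      unfolding inner_hadjoint[symmetric] P .
    then show ?thesis
      unfolding matrix_eq_inner by blast
  qed
  moreover have "range ((*v) P) = S"
    using pS pfix by (auto simp: P image_iff) metis
  ultimately show ?thesis
    unfolding is_orth_proj_def by blast
qed

lemma orth_proj_eq: "is_orth_proj P S \<Longrightarrow> orth_proj S = P"
  unfolding orth_proj_def
  by (rule the_equality) (auto simp: is_orth_proj_def[symmetric] intro: is_orth_proj_unique)

lemma is_orth_proj_orth_proj: "vec.subspace S \<Longrightarrow> is_orth_proj (orth_proj S) S"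
  using is_orth_proj_exists[of S] orth_proj_eq by metis

lemma is_orth_proj_unitary_image:
  assumes U: "unitary U" and P: "is_orth_proj P S"
  shows "is_orth_proj (U ** P ** hadjoint U) ((*v) U ` S)"
proof -
  have UU: "hadjoint U ** U = mat 1"
    using U by (simp add: unitary_def)
  have "U ** P ** hadjoint U ** (U ** P ** hadjoint U) = U ** P ** (hadjoint U ** U) ** P ** hadjoint U"
    by (simp only: matrix_mul_assoc)
  also have "\<dots> = U ** (P ** P) ** hadjoint U"
    by (simp only: UU matrix_mul_rid matrix_mul_assoc)
  finally have "U ** P ** hadjoint U ** (U ** P ** hadjoint U) = U ** P ** hadjoint U"
    using P by (simp add: is_orth_proj_def)
  moreover have "hadjoint (U ** P ** hadjoint U) = U ** P ** hadjoint U"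
    using P by (simp add: is_orth_proj_def hadjoint_mult matrix_mul_assoc)
  moreover have "range ((*v) (U ** P ** hadjoint U)) = (*v) U ` S"
  proof -
    have "surj ((*v) (hadjoint U))"
      unfolding surj_def by (metis UU matrix_vector_mul_assoc matrix_vector_mul_lid)
    then have "range ((*v) (U ** P ** hadjoint U)) = (*v) U ` range ((*v) P)"
      by (metis (no_types, lifting) ext image_image matrix_vector_mul_assoc)
    then show ?thesis
      using P by (simp add: is_orth_proj_def)
  qed
  ultimately show ?thesis
    by (simp add: is_orth_proj_def)
qed

section \<open>Traces\<close>

text \<open>In a basis \<open>B\<close> of the range, \<open>Q *v x\<close> has coordinates
  \<open>\<phi> b x\<close>, and the trace becomes the sum of all \<open>\<phi> b b\<close>. Each of
  these is 1 because \<open>Q\<close> fixes its range.\<close>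

lemma trace_idempotent:
  fixes Q :: "'a::field ^ 'n ^ 'n"
  assumes "Q ** Q = Q"
  shows "trace Q = of_nat (vec.dim (range ((*v) Q)))"
proof -
  let ?V = "range ((*v) Q)"
  obtain B where B: "B \<subseteq> ?V" "vec.independent B" "?V \<subseteq> vec.span B" "card B = vec.dim ?V"
    using vec.basis_exists[of ?V] by auto
  have fin: "finite B"
    using B(2) vec.finiteI_independent by blast
  define \<phi> where "\<phi> b x = vec.representation B (Q *v x) b" for b x
  have sp: "Q *v x \<in> vec.span B" for x
    using B(3) by auto
  have expand: "(\<Sum>b\<in>B. \<phi> b x *s b) = Q *v x" for x
    unfolding \<phi>_def by (rule vec.sum_representation_eq[OF B(2) sp fin]) simp
  have \<phi>_sum: "(\<Sum>i\<in>UNIV. x $ i * \<phi> b (axis i 1)) = \<phi> b x" for b x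
  proof -
    have "Q *v x = (\<Sum>i\<in>UNIV. x $ i *s (Q *v axis i 1))"
      by (metis (no_types, lifting) basis_expansion sum.cong vec.scale vec.sum)
    then have "vec.representation B (Q *v x) b
        = (\<Sum>i\<in>UNIV. vec.representation B (x $ i *s (Q *v axis i 1)) b)"
      by (simp add: vec.representation_sum[OF B(2)] vec.span_scale sp)
    then show ?thesis
      by (simp add: \<phi>_def vec.representation_scale[OF B(2) sp])
  qed
  have \<phi>_basis: "\<phi> b b = 1" if "b \<in> B" for b
  proof -
    have "Q *v b = b"
      using that B(1) assms by (auto simp: matrix_vector_mul_assoc)
    then show ?thesis
      using vec.representation_basis[OF B(2) that] by (simp add: \<phi>_def)
  qed
  have "trace Q = (\<Sum>i\<in>UNIV. (Q *v axis i 1) $ i)"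
    by (simp add: trace_def matrix_vector_mult_def axis_def if_distrib[of "(*) _"] cong: if_cong)
  also have "\<dots> = (\<Sum>i\<in>UNIV. \<Sum>b\<in>B. b $ i * \<phi> b (axis i 1))"
    by (simp add: mult.commute flip: expand)
  also have "\<dots> = (\<Sum>b\<in>B. \<phi> b b)"
    by (subst sum.swap) (simp add: \<phi>_sum)
  also have "\<dots> = of_nat (vec.dim ?V)"
    using \<phi>_basis B(4) by simp
  finally show ?thesis .
qed

lemma trace_hadjoint_mult_nonneg: "Re (trace (hadjoint R ** R)) \<ge> 0"
  by (simp add: trace_def matrix_matrix_mult_def hadjoint_def sum_nonneg)

text \<open>With \<open>K\<close> the projector onto the intersection, \<open>Q - K\<close> projects
  onto its orthogonal complement within \<open>V\<close>. As \<open>K ** P\<close> has trace 0 and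
  \<open>P\<close> is at most the identity, the trace of \<open>Q ** P\<close> is at most that of
  \<open>Q - K\<close>.\<close>

lemma trace_orth_proj_mult_le:
  fixes P Q :: "complex ^ 'n ^ 'n"
  assumes P: "P ** P = P" "hadjoint P = P" and Q: "is_orth_proj Q V"
  shows "Re (trace (Q ** P)) \<le> real (vec.dim V) - real (vec.dim (V \<inter> matrix_kernel P))"
proof -
  have V: "vec.subspace V"
    using Q subspace_range_matrix by (auto simp: is_orth_proj_def)
  obtain K where K: "is_orth_proj K (V \<inter> matrix_kernel P)"
    using is_orth_proj_exists[OF vec.subspace_inter[OF V subspace_matrix_kernel]] by blast
  have "K *v x \<in> matrix_kernel P" for x
    using K by (auto simp: is_orth_proj_def)
  then have PK: "P ** K = 0"
    by (simp add: matrix_eq matrix_kernel_def matrix_vector_mul_assoc)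
  have "Q *v (K *v x) = K *v x" for x
    using K by (intro is_orth_proj_fixes[OF Q]) (auto simp: is_orth_proj_def)
  then have QK: "Q ** K = K"
    by (simp add: matrix_eq matrix_vector_mul_assoc)
  then have KQ: "K ** Q = K"
    using K Q by (metis hadjoint_mult is_orth_proj_def)
  \<comment> \<open>\<open>hadjoint R ** R\<close> is
    \<open>(Q - K) ** (mat 1 - P) ** (Q - K)\<close>; cyclicity of the trace then removes one factor
    \<open>Q - K\<close>.\<close>
  define R where "R = (mat 1 - P) ** (Q - K)"
  have diffl: "(A - B) ** C = A ** C - B ** C" and diffr: "C ** (A - B) = C ** A - C ** B"
    for A B C :: "complex ^ 'n ^ 'n"
    by (simp_all add: matrix_matrix_mult_def vec_eq_iff algebra_simps sum_subtractf)
  have "hadjoint R ** R = (Q - K) ** ((mat 1 - P) ** (mat 1 - P)) ** (Q - K)"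
    using P K Q by (simp add: R_def hadjoint_mult hadjoint_diff is_orth_proj_def matrix_mul_assoc)
  also have "(mat 1 - P) ** (mat 1 - P) = mat 1 - P"
    by (simp add: diffl diffr P)
  finally have RR: "hadjoint R ** R = ((Q - K) ** (mat 1 - P)) ** (Q - K)" .
  have "trace (hadjoint R ** R) = trace ((Q - K) ** ((Q - K) ** (mat 1 - P)))"
    unfolding RR by (rule trace_mul_sym)
  also have "(Q - K) ** ((Q - K) ** (mat 1 - P)) = (Q - K) ** (mat 1 - P)"
    using Q K by (simp add: matrix_mul_assoc diffl diffr QK KQ is_orth_proj_def)
  also have "trace \<dots> = trace Q - trace K - trace (Q ** P) + trace (K ** P)"
    by (simp add: diffl diffr trace_sub)
  also have "trace (K ** P) = 0"
    by (subst trace_mul_sym) (simp add: PK trace_def)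
  also have "trace Q = of_nat (vec.dim V)"
    using Q trace_idempotent[of Q] by (simp add: is_orth_proj_def)
  also have "trace K = of_nat (vec.dim (V \<inter> matrix_kernel P))"
    using K trace_idempotent[of K] by (simp add: is_orth_proj_def)
  finally show ?thesis
    using trace_hadjoint_mult_nonneg[of R] by simp
qed

section \<open>The dimension of the kernel\<close>

lemma det_nz_iff_trivial_kernel:
  "det A \<noteq> 0 \<longleftrightarrow> (\<forall>x. A *v x = 0 \<longrightarrow> x = 0)" for A :: "'a::field ^ 'n ^ 'n"
  by (simp add: invertible_det_nz[symmetric] invertible_left_inverse matrix_left_invertible_ker)

text \<open>On the kernel of \<open>A\<close> the invertible \<open>A + B\<close> acts as
  \<open>B\<close>, so \<open>B\<close> is injective there.\<close>

lemma dim_kernel_le_of_det: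
  assumes "det (A + B) \<noteq> 0"
  shows "vec.dim (matrix_kernel A) \<le> vec.dim (range ((*v) B))"
proof -
  let ?K = "matrix_kernel A"
  have inj: "x = 0" if "A *v x + B *v x = 0" for x
    using assms that unfolding det_nz_iff_trivial_kernel matrix_vector_mult_add_rdistrib by blast
  have "inj_on ((*v) B) ?K"
  proof (rule inj_onI)
    fix x y assume "x \<in> ?K" "y \<in> ?K" "B *v x = B *v y"
    then have "x - y = 0"
      by (intro inj[of "x - y"]) (simp add: matrix_kernel_def matrix_vector_mult_diff_distrib)
    then show "x = y" by simp
  qed
  then have "vec.dim ((*v) B ` ?K) = vec.dim ?K"
    by (intro vec.dim_image_eq) (simp_all add: vec.span_eq_iff[THEN iffD2, OF subspace_matrix_kernel])
  moreover have "vec.dim ((*v) B ` ?K) \<le> vec.dim (range ((*v) B))"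
    by (rule vec.dim_subset) auto
  ultimately show ?thesis by simp
qed

text \<open>For Hermitian \<open>A\<close>, \<open>K ** A = 0\<close> is the adjoint of
  \<open>A ** K = 0\<close>. Applying \<open>K\<close> to \<open>A *v x + K *v x = 0\<close>
  therefore isolates \<open>K *v x = 0\<close>; then \<open>x\<close> lies in the kernel and is
  fixed by \<open>K\<close>.\<close>

lemma det_add_kernel_projector:
  assumes A: "hadjoint A = A" and K: "is_orth_proj K (matrix_kernel A)"
  shows "det (A + K) \<noteq> 0"
  unfolding det_nz_iff_trivial_kernel
proof (intro allI impI)
  fix x assume "(A + K) *v x = 0"
  then have sum0: "A *v x + K *v x = 0"
    by (simp add: matrix_vector_mult_add_rdistrib)
  have "K *v y \<in> matrix_kernel A" for y
    using K by (auto simp: is_orth_proj_def)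
  then have "A ** K = 0"
    by (simp add: matrix_eq matrix_kernel_def matrix_vector_mul_assoc)
  then have KA: "K ** A = 0"
    using A K by (metis hadjoint_mult is_orth_proj_def hadjoint_mat mat_0 complex_cnj_zero)
  have "K *v (A *v x + K *v x) = K *v x"
    using K KA by (simp add: matrix_vector_right_distrib matrix_vector_mul_assoc is_orth_proj_def)
  then have "K *v x = 0"
    by (simp add: sum0)
  moreover from this have "x \<in> matrix_kernel A"
    using sum0 by (simp add: matrix_kernel_def)
  ultimately show "x = 0"
    using is_orth_proj_fixes[OF K] by simp
qed

text \<open>A kernel of dimension at most \<open>c\<close> is witnessed by some \<open>B\<close> of
  rank at most \<open>c\<close> that makes \<open>hadjoint A ** A + B\<close> invertible, an open
  condition on \<open>A\<close>. The kernel projector serves as \<open>B\<close>.\<close>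

lemma open_dim_kernel_le: "open {A :: complex ^ 'n ^ 'n. vec.dim (matrix_kernel A) \<le> c}"
proof -
  have cont: "continuous_on UNIV (\<lambda>A :: complex ^ 'n ^ 'n. det (hadjoint A ** A + B))" for B
    unfolding det_def hadjoint_def matrix_matrix_mult_def
    by (simp, intro continuous_intros)
  have "{A :: complex ^ 'n ^ 'n. vec.dim (matrix_kernel A) \<le> c}
      = (\<Union>B\<in>{B. vec.dim (range ((*v) B)) \<le> c}. {A. det (hadjoint A ** A + B) \<noteq> 0})" (is "?L = ?R")
  proof (intro equalityI subsetI)
    fix A assume "A \<in> ?L"
    moreover obtain K where K: "is_orth_proj K (matrix_kernel (hadjoint A ** A))"
      using is_orth_proj_exists subspace_matrix_kernel by blast
    moreover have "det (hadjoint A ** A + K) \<noteq> 0"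
      using K by (intro det_add_kernel_projector) (simp_all add: hadjoint_mult)
    ultimately show "A \<in> ?R"
      by (intro UN_I[of K]) (auto simp: is_orth_proj_def matrix_kernel_hadjoint_mult)
  next
    fix A assume "A \<in> ?R"
    then show "A \<in> ?L"
      using dim_kernel_le_of_det[of "hadjoint A ** A"]
      by (fastforce simp: matrix_kernel_hadjoint_mult)
  qed
  moreover have "open {A :: complex ^ 'n ^ 'n. det (hadjoint A ** A + B) \<noteq> 0}" for B :: "complex ^ 'n ^ 'n"
    by (rule open_Collect_neq[OF cont continuous_on_const])
  ultimately show ?thesis
    by (simp add: open_UN)
qed

lemma measurable_dim_kernel [measurable]:
  "(\<lambda>A :: complex ^ 'n ^ 'n. real (vec.dim (matrix_kernel A))) \<in> borel_measurable borel"
proof (rule borel_measurableI_le)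
  fix a :: real
  have "{A :: complex ^ 'n ^ 'n. real (vec.dim (matrix_kernel A)) \<le> a}
      = (if a < 0 then {} else {A. vec.dim (matrix_kernel A) \<le> nat \<lfloor>a\<rfloor>})"
    by (auto simp: le_nat_iff le_floor_iff)
  then show "{A \<in> space borel. real (vec.dim (matrix_kernel (A :: complex ^ 'n ^ 'n))) \<le> a} \<in> sets borel"
    by (simp add: borel_open open_dim_kernel_le)
qed

section \<open>Operators on some of the qubits\<close>

lemma on_qubits_add: "on_qubits e (A + B) = on_qubits e A + on_qubits e B"
  by (auto simp: on_qubits_def vec_eq_iff)

lemma on_qubits_0 [simp]: "on_qubits e 0 = 0"
  by (simp add: on_qubits_def vec_eq_iff)

lemma on_qubits_sum: "on_qubits e (sum f X) = (\<Sum>x\<in>X. on_qubits e (f x))"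
  by (induction X rule: infinite_finite_induct) (simp_all add: on_qubits_add)

lemma hadjoint_on_qubits: "hadjoint (on_qubits e A) = on_qubits e (hadjoint A)"
  by (auto simp: on_qubits_def hadjoint_def vec_eq_iff)

lemma on_qubits_mat: "on_qubits e (mat c) = mat c"
proof -
  have "s = t" if "\<forall>v. v \<notin> range e \<longrightarrow> s v = t v" "s \<circ> e = t \<circ> e" for s t :: "'a \<Rightarrow> bool"
  proof
    show "s v = t v" for v
      using that by (cases "v \<in> range e") (auto simp: fun_eq_iff)
  qed
  then show ?thesis
    unfolding on_qubits_def mat_def vec_eq_iff by auto
qed

text \<open>Only intermediate assignments \<open>u\<close> agreeing with \<open>s\<close> off the
  edge contribute; composition with the injective \<open>e\<close> matches them with the assignments
  of the edge qubits.\<close>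

lemma on_qubits_mult:
  fixes e :: "'k::finite \<Rightarrow> 'v::finite"
  assumes "inj e"
  shows "on_qubits e A ** on_qubits e B = on_qubits e (A ** B)"
proof -
  have "(\<Sum>u\<in>UNIV. on_qubits e A $ s $ u * on_qubits e B $ u $ t) = on_qubits e (A ** B) $ s $ t" for s t
  proof (cases "\<forall>v. v \<notin> range e \<longrightarrow> s v = t v")
    case True
    let ?U = "{u. \<forall>v. v \<notin> range e \<longrightarrow> s v = u v}"
    \<comment> \<open>The inverse of \<open>u \<circ> e\<close>: values from \<open>w\<close> on the
      edge, from \<open>s\<close> elsewhere.\<close>
    let ?ext = "\<lambda>w v. if v \<in> range e then w (inv e v) else s v"
    have "(\<Sum>u\<in>UNIV. on_qubits e A $ s $ u * on_qubits e B $ u $ t)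
        = (\<Sum>u\<in>?U. A $ (s \<circ> e) $ (u \<circ> e) * B $ (u \<circ> e) $ (t \<circ> e))"
      using True by (intro sum.mono_neutral_cong_right) (auto simp: on_qubits_def)
    also have "\<dots> = (\<Sum>w\<in>UNIV. A $ (s \<circ> e) $ w * B $ w $ (t \<circ> e))"
    proof (rule sum.reindex_bij_witness[where j = "\<lambda>u. u \<circ> e" and i = ?ext])
      fix u assume "u \<in> ?U"
      then show "?ext (u \<circ> e) = u"
        by (auto simp: fun_eq_iff f_inv_into_f)
    next
      fix w :: "'k \<Rightarrow> bool"
      show "?ext w \<circ> e = w"
        using assms by (simp add: fun_eq_iff)
    qed auto
    also have "\<dots> = on_qubits e (A ** B) $ s $ t"
      using True by (simp add: on_qubits_def matrix_matrix_mult_def)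
    finally show ?thesis .
  next
    case False
    then have "on_qubits e A $ s $ u * on_qubits e B $ u $ t = 0" for u
      by (auto simp: on_qubits_def)
    moreover have "on_qubits e (A ** B) $ s $ t = 0"
      using False by (auto simp: on_qubits_def)
    ultimately show ?thesis by (simp only: sum.neutral_const)
  qed
  then show ?thesis
    by (simp add: matrix_matrix_mult_def[of "on_qubits e A"] vec_eq_iff)
qed

section \<open>Twirling over sign changes and bit flips\<close>

text \<open>All sign patterns on the basis states are allowed, not only products of Pauli Z
  matrices.\<close>

definition signs :: "('n \<Rightarrow> bool) \<Rightarrow> complex ^ 'n ^ 'n" where
  "signs \<epsilon> = (\<chi> s t. if s = t then if \<epsilon> s then 1 else - 1 else 0)"

definition flip :: "('k \<Rightarrow> bool) \<Rightarrow> ('k \<Rightarrow> bool) \<Rightarrow> 'k \<Rightarrow> bool" where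
  "flip a s = (\<lambda>i. s i \<noteq> a i)"

text \<open>The product of the Pauli X matrices over the qubits where \<open>a\<close> is
  true.\<close>

definition flips :: "('k::finite \<Rightarrow> bool) \<Rightarrow> complex ^ ('k \<Rightarrow> bool) ^ ('k \<Rightarrow> bool)" where
  "flips a = (\<chi> s t. if t = flip a s then 1 else 0)"

definition involution :: "complex ^ 'n ^ 'n \<Rightarrow> bool" where
  "involution g \<longleftrightarrow> hadjoint g = g \<and> g ** g = mat 1"

lemma flip_flip [simp]: "flip a (flip a s) = s"
  by (auto simp: flip_def)

lemma flip_flip_right [simp]: "flip (flip a s) s = a"
  by (auto simp: flip_def)

lemma flip_commute: "flip a s = flip s a"
  by (auto simp: flip_def)

lemma signs_mult: "(signs \<epsilon> ** A) $ s $ t = (if \<epsilon> s then 1 else - 1) * A $ s $ t"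
  and mult_signs: "(A ** signs \<epsilon>) $ s $ t = (if \<epsilon> t then 1 else - 1) * A $ s $ t"
  by (simp_all add: signs_def matrix_matrix_mult_def if_distrib[of "\<lambda>x. x * _"] if_distrib[of "(*) _"]
      sum.delta sum.delta' cong: if_cong)

lemma flips_mult: "(flips a ** A) $ s $ t = A $ flip a s $ t"
  and mult_flips: "(A ** flips a) $ s $ t = A $ s $ flip a t"
proof -
  have *: "t = flip a u \<longleftrightarrow> u = flip a t" for u t :: "'a \<Rightarrow> bool"
    by (metis flip_flip)
  show "(flips a ** A) $ s $ t = A $ flip a s $ t"
    by (simp add: flips_def matrix_matrix_mult_def if_distrib[of "\<lambda>x. x * _"] cong: if_cong)
  show "(A ** flips a) $ s $ t = A $ s $ flip a t"
    by (simp add: flips_def matrix_matrix_mult_def * if_distrib[of "(*) _"] cong: if_cong)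
qed

lemma involution_signs: "involution (signs \<epsilon>)"
  unfolding involution_def vec_eq_iff signs_mult
  by (auto simp: hadjoint_def signs_def mat_def)

lemma involution_flips: "involution (flips a)"
  unfolding involution_def vec_eq_iff flips_mult
  by (auto simp: hadjoint_def flips_def mat_def)

lemma involution_unitary: "involution g \<Longrightarrow> unitary g"
  by (simp add: involution_def unitary_def)

lemma is_orth_proj_flips_signs:
  assumes "is_orth_proj P S"
  shows "is_orth_proj (flips a ** (signs \<epsilon> ** P ** signs \<epsilon>) ** flips a) ((*v) (flips a) ` (*v) (signs \<epsilon>) ` S)"
  using is_orth_proj_unitary_image[OF involution_unitary[OF involution_flips[of a]]
      is_orth_proj_unitary_image[OF involution_unitary[OF involution_signs[of \<epsilon>]] assms]]
    involution_flips[of a] involution_signs[of \<epsilon>]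
  by (simp add: involution_def)

text \<open>For distinct \<open>s\<close> and \<open>t\<close>, toggling \<open>\<epsilon>\<close>
  at \<open>s\<close> is a bijection that negates every summand.\<close>

lemma sum_signs:
  fixes s t :: "'n::finite"
  shows "(\<Sum>\<epsilon>\<in>UNIV. (if \<epsilon> s then 1 else - 1) * (if \<epsilon> t then 1 else - 1)) = (if s = t then 2 ^ CARD('n) else (0::complex))"
    (is "sum ?f UNIV = _")
proof (cases "s = t")
  case True
  then have "sum ?f UNIV = (\<Sum>\<epsilon>\<in>(UNIV :: ('n \<Rightarrow> bool) set). 1)"
    by (intro sum.cong) auto
  then show ?thesis
    using True by (simp add: card_fun)
next
  case False
  have "sum ?f UNIV = (\<Sum>\<epsilon>\<in>UNIV. - ?f \<epsilon>)"
    by (rule sum.reindex_bij_witness[where i = "\<lambda>\<epsilon>. \<epsilon>(s := \<not> \<epsilon> s)" and j = "\<lambda>\<epsilon>. \<epsilon>(s := \<not> \<epsilon> s)"])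
       (use False in auto)
  then show ?thesis
    using False by (simp add: sum_negf)
qed

text \<open>Summing over signs kills the off-diagonal entries; summing over flips then brings every
  diagonal entry once to each position, which leaves the trace. The power of 2 counts the sign
  patterns.\<close>

lemma twirl:
  fixes A :: "complex ^ ('k::finite \<Rightarrow> bool) ^ ('k \<Rightarrow> bool)"
  shows "(\<Sum>a\<in>UNIV. \<Sum>\<epsilon>\<in>UNIV. flips a ** (signs \<epsilon> ** A ** signs \<epsilon>) ** flips a)
    = mat (2 ^ CARD('k \<Rightarrow> bool) * trace A)"
proof -
  have "(\<Sum>a\<in>UNIV. \<Sum>\<epsilon>\<in>UNIV. flips a ** (signs \<epsilon> ** A ** signs \<epsilon>) ** flips a) $ s $ t
      = mat (2 ^ CARD('k \<Rightarrow> bool) * trace A) $ s $ t" for s t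
  proof -
    have "(\<Sum>a\<in>UNIV. \<Sum>\<epsilon>\<in>UNIV. flips a ** (signs \<epsilon> ** A ** signs \<epsilon>) ** flips a) $ s $ t
        = (\<Sum>a\<in>UNIV. \<Sum>\<epsilon>\<in>UNIV. (if \<epsilon> (flip a s) then 1 else - 1) * (if \<epsilon> (flip a t) then 1 else - 1)
            * A $ flip a s $ flip a t)"
      by (simp only: sum_component mult_flips flips_mult mult_signs signs_mult mult_ac)
    also have "\<dots> = (\<Sum>a\<in>UNIV. (if flip a s = flip a t then 2 ^ CARD('k \<Rightarrow> bool) else 0) * A $ flip a s $ flip a t)"
      by (simp only: sum_signs flip: sum_distrib_right)
    also have "\<dots> = (if s = t then 2 ^ CARD('k \<Rightarrow> bool) * (\<Sum>a\<in>UNIV. A $ flip a s $ flip a s) else 0)"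
    proof -
      have "flip a s = flip a t \<longleftrightarrow> s = t" for a
        by (metis flip_flip)
      then show ?thesis
        by (simp add: sum_distrib_left)
    qed
    also have "(\<Sum>a\<in>UNIV. A $ flip a s $ flip a s) = trace A"
      unfolding trace_def
      by (rule sum.reindex_bij_witness[where i = "flip s" and j = "flip s"])
         (simp_all add: flip_commute[of s])
    finally show ?thesis
      by (simp add: mat_def)
  qed
  then show ?thesis
    by (simp add: vec_eq_iff)
qed

text \<open>If every conjugate violated the bound, the trace inequality would put each
  \<open>trace (Q ** T a \<epsilon>)\<close> strictly below the average over all conjugates, which
  \<open>twirl\<close> computes.\<close>

lemma exists_flips_signs_dim_le:
  fixes e :: "'k::finite \<Rightarrow> 'v::finite" and P :: "complex ^ ('k \<Rightarrow> bool) ^ ('k \<Rightarrow> bool)"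
  assumes e: "inj e" and P: "is_orth_proj P S" and V: "vec.subspace V"
  shows "\<exists>a \<epsilon>. real (vec.dim (V \<inter> matrix_kernel (on_qubits e (flips a ** (signs \<epsilon> ** P ** signs \<epsilon>) ** flips a))))
    \<le> (1 - real (vec.dim S) / 2 ^ CARD('k)) * real (vec.dim V)"
proof (rule ccontr)
  define T where "T a \<epsilon> = on_qubits e (flips a ** (signs \<epsilon> ** P ** signs \<epsilon>) ** flips a)" for a \<epsilon>
  define d where "d = real (vec.dim V)"
  define n where "n = CARD('k \<Rightarrow> bool)"
  assume "\<not> ?thesis"
  then have big: "(1 - real (vec.dim S) / n) * d < real (vec.dim (V \<inter> matrix_kernel (T a \<epsilon>)))" for a \<epsilon>
    by (simp add: T_def d_def n_def card_fun not_le)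
  obtain Q where Q: "is_orth_proj Q V"
    using is_orth_proj_exists[OF V] by blast
  note T = is_orth_proj_flips_signs[OF P]
  have le: "Re (trace (Q ** T a \<epsilon>)) < real (vec.dim S) / n * d" for a \<epsilon>
  proof -
    have "Re (trace (Q ** T a \<epsilon>)) \<le> d - real (vec.dim (V \<inter> matrix_kernel (T a \<epsilon>)))"
      unfolding d_def using T[of a \<epsilon>] e
      by (intro trace_orth_proj_mult_le Q)
         (simp_all add: T_def on_qubits_mult hadjoint_on_qubits is_orth_proj_def)
    then show ?thesis
      using big[of a \<epsilon>] by (simp add: algebra_simps)
  qed
  have tmat: "trace (Q ** mat c) = c * trace Q" for c
    by (simp add: trace_def matrix_matrix_mult_def mat_def if_distrib[of "(*) _"] sum_distrib_left mult.commute cong: if_cong)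
  have trace_sum: "trace (sum f X) = (\<Sum>x\<in>X. trace (f x))" for f :: "'i \<Rightarrow> complex ^ ('v \<Rightarrow> bool) ^ ('v \<Rightarrow> bool)" and X
    unfolding trace_def by (simp only: sum_component sum.swap[of _ X])
  have mult_sum: "Q ** sum f X = (\<Sum>x\<in>X. Q ** f x)" for f :: "'i \<Rightarrow> complex ^ ('v \<Rightarrow> bool) ^ ('v \<Rightarrow> bool)" and X
    by (induction X rule: infinite_finite_induct) (simp_all add: matrix_add_ldistrib)
  have "(\<Sum>a\<in>UNIV. \<Sum>\<epsilon>\<in>UNIV. T a \<epsilon>) = mat (2 ^ n * of_nat (vec.dim S))"
  proof -
    have "(\<Sum>a\<in>UNIV. \<Sum>\<epsilon>\<in>UNIV. T a \<epsilon>) = on_qubits e (mat (2 ^ n * trace P))"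
      unfolding T_def n_def by (simp only: twirl flip: on_qubits_sum)
    also have "trace P = of_nat (vec.dim S)"
      using P trace_idempotent[of P] by (auto simp: is_orth_proj_def)
    finally show ?thesis
      by (simp add: on_qubits_mat)
  qed
  then have "(\<Sum>a\<in>UNIV. \<Sum>\<epsilon>\<in>UNIV. trace (Q ** T a \<epsilon>)) = 2 ^ n * of_nat (vec.dim S) * trace Q"
    by (simp add: tmat flip: trace_sum mult_sum)
  also have "trace Q = of_nat (vec.dim V)"
    using Q trace_idempotent[of Q] by (auto simp: is_orth_proj_def)
  finally have "(\<Sum>a\<in>UNIV. \<Sum>\<epsilon>\<in>UNIV. trace (Q ** T a \<epsilon>)) = of_real (2 ^ n * real (vec.dim S) * d)"
    by (simp add: d_def)
  then have "Re (\<Sum>a\<in>UNIV. \<Sum>\<epsilon>\<in>UNIV. trace (Q ** T a \<epsilon>)) = 2 ^ n * real (vec.dim S) * d"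
    by (simp only: Re_complex_of_real)
  then have "2 ^ n * real (vec.dim S) * d = (\<Sum>a\<in>UNIV. \<Sum>\<epsilon>\<in>UNIV. Re (trace (Q ** T a \<epsilon>)))"
    by simp
  \<comment> \<open>There are \<open>n\<close> flips and \<open>2 ^ n\<close> sign patterns, so the
    right-hand side adds up to the very number on the left.\<close>
  also have "\<dots> < (\<Sum>a\<in>(UNIV :: ('k \<Rightarrow> bool) set). \<Sum>\<epsilon>\<in>(UNIV :: (('k \<Rightarrow> bool) \<Rightarrow> bool) set). real (vec.dim S) / n * d)"
    by (intro sum_strict_mono le) auto
  also have "\<dots> = 2 ^ n * real (vec.dim S) * d"
    by (simp add: card_fun n_def)
  finally show False by simp
qed

section \<open>A curve of unitaries through an involution\<close>

definition poly_fun :: "(real \<Rightarrow> complex) \<Rightarrow> bool" where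
  "poly_fun f \<longleftrightarrow> (\<exists>p. \<forall>x. f x = poly p (of_real x))"

lemma poly_fun_const: "poly_fun (\<lambda>_. c)"
  unfolding poly_fun_def by (rule exI[of _ "[:c:]"]) simp

lemma poly_fun_of_real: "poly_fun of_real"
  unfolding poly_fun_def by (rule exI[of _ "[:0, 1:]"]) simp

lemma poly_fun_add: "poly_fun f \<Longrightarrow> poly_fun h \<Longrightarrow> poly_fun (\<lambda>x. f x + h x)"
  unfolding poly_fun_def by (metis poly_add)

lemma poly_fun_mult: "poly_fun f \<Longrightarrow> poly_fun h \<Longrightarrow> poly_fun (\<lambda>x. f x * h x)"
  unfolding poly_fun_def by (metis poly_mult)

lemma poly_fun_sum: "(\<And>i. i \<in> X \<Longrightarrow> poly_fun (f i)) \<Longrightarrow> poly_fun (\<lambda>x. \<Sum>i\<in>X. f i x)"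
  by (induction X rule: infinite_finite_induct) (auto intro: poly_fun_const poly_fun_add)

lemma poly_fun_prod: "(\<And>i. i \<in> X \<Longrightarrow> poly_fun (f i)) \<Longrightarrow> poly_fun (\<lambda>x. \<Prod>i\<in>X. f i x)"
  by (induction X rule: infinite_finite_induct) (auto intro: poly_fun_const poly_fun_mult)

lemmas poly_fun_intros = poly_fun_const poly_fun_of_real poly_fun_add poly_fun_mult poly_fun_sum poly_fun_prod

lemma poly_fun_finite_zeros:
  assumes "poly_fun f" "f x0 \<noteq> 0"
  shows "finite {x. f x = 0}"
proof -
  obtain p where p: "\<And>x. f x = poly p (of_real x)"
    using assms(1) by (auto simp: poly_fun_def)
  then have "p \<noteq> 0"
    using assms(2) by auto
  then have "finite (of_real -` {z. poly p z = 0})"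
    by (intro finite_vimageI poly_roots_finite) (simp_all add: inj_on_def)
  then show ?thesis
    by (simp add: p vimage_def)
qed

definition poly_matrix :: "(real \<Rightarrow> complex ^ 'n ^ 'm) \<Rightarrow> bool" where
  "poly_matrix M \<longleftrightarrow> (\<forall>i j. poly_fun (\<lambda>x. M x $ i $ j))"

lemma poly_matrix_const: "poly_matrix (\<lambda>_. A)"
  by (simp add: poly_matrix_def poly_fun_const)

lemma poly_matrix_add: "poly_matrix M \<Longrightarrow> poly_matrix N \<Longrightarrow> poly_matrix (\<lambda>x. M x + N x)"
  by (simp add: poly_matrix_def poly_fun_add)

lemma poly_matrix_mult: "poly_matrix M \<Longrightarrow> poly_matrix N \<Longrightarrow> poly_matrix (\<lambda>x. M x ** N x)"
  by (simp add: poly_matrix_def matrix_matrix_mult_def poly_fun_sum poly_fun_mult)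

lemma poly_matrix_on_qubits:
  assumes "poly_matrix M"
  shows "poly_matrix (\<lambda>x. on_qubits e (M x))"
proof -
  have "poly_fun (\<lambda>x. if b then M x $ i $ j else 0)" for b i j
    using assms by (cases b) (simp_all add: poly_matrix_def poly_fun_const)
  then show ?thesis
    by (simp add: poly_matrix_def on_qubits_def)
qed

lemma poly_fun_det: "poly_matrix M \<Longrightarrow> poly_fun (\<lambda>x. det (M x))"
  unfolding poly_matrix_def det_def by (intro poly_fun_intros) auto

section \<open>Complex multiples of matrices\<close>

definition cscale :: "complex \<Rightarrow> complex ^ 'n ^ 'm \<Rightarrow> complex ^ 'n ^ 'm" where
  "cscale c A = (\<chi> i j. c * A $ i $ j)"

lemma cscale_mult [simp]: "cscale c A ** B = cscale c (A ** B)" "A ** cscale c B = cscale c (A ** B)"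
  by (simp_all add: cscale_def matrix_matrix_mult_def sum_distrib_left mult_ac)

lemma cscale_cscale [simp]: "cscale c (cscale d A) = cscale (c * d) A"
  by (simp add: cscale_def mult_ac)

lemma cscale_add: "cscale c (A + B) = cscale c A + cscale c B"
  by (simp add: cscale_def vec_eq_iff distrib_left)

lemma cscale_one [simp]: "cscale 1 A = A"
  by (simp add: cscale_def vec_eq_iff)

lemma hadjoint_cscale: "hadjoint (cscale c A) = cscale (cnj c) (hadjoint A)"
  by (simp add: cscale_def hadjoint_def vec_eq_iff)

lemma on_qubits_cscale: "on_qubits e (cscale c A) = cscale c (on_qubits e A)"
  by (auto simp: cscale_def on_qubits_def vec_eq_iff)

text \<open>Invertibility is compared through kernels, so the power of \<open>c\<close> in the
  determinant need not be computed.\<close>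

lemma det_cscale_nz: "c \<noteq> 0 \<Longrightarrow> det (cscale c A) \<noteq> 0 \<longleftrightarrow> det A \<noteq> 0"
proof -
  assume "c \<noteq> 0"
  moreover have "cscale c A *v x = c *s (A *v x)" for x
    by (simp add: cscale_def matrix_vector_mult_def vec_eq_iff sum_distrib_left mult_ac)
  ultimately show ?thesis
    unfolding det_nz_iff_trivial_kernel by simp
qed

lemma poly_matrix_cscale: "poly_fun f \<Longrightarrow> poly_matrix M \<Longrightarrow> poly_matrix (\<lambda>x. cscale (f x) (M x))"
  by (simp add: poly_matrix_def cscale_def poly_fun_mult)

section \<open>The curve and conjugation along it\<close>

definition gcurve :: "complex ^ 'n ^ 'n \<Rightarrow> real \<Rightarrow> complex ^ 'n ^ 'n" where
  "gcurve g x = mat 1 + cscale (\<i> * of_real x) g"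

text \<open>For an involution \<open>g\<close> this is the exponential of
  \<open>\<i> \<theta> g\<close> with \<open>\<theta> = arctan x\<close>. Only the normalising
  factor fails to be polynomial in \<open>x\<close>.\<close>

definition ucurve :: "complex ^ 'n ^ 'n \<Rightarrow> real \<Rightarrow> complex ^ 'n ^ 'n" where
  "ucurve g x = cscale (of_real (1 / sqrt (1 + x\<^sup>2))) (gcurve g x)"

lemma matrix_add_rdistrib: "(A + B) ** C = A ** C + B ** C" for A B :: "'a::semiring_1 ^ 'n ^ 'm"
  by (simp add: matrix_matrix_mult_def vec_eq_iff distrib_right sum.distrib)

lemma hadjoint_gcurve: "involution g \<Longrightarrow> hadjoint (gcurve g x) = gcurve g (- x)"
  by (simp add: gcurve_def hadjoint_add hadjoint_cscale involution_def)

lemma gcurve_mult: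
  assumes "involution g"
  shows "gcurve g x ** gcurve g (- x) = cscale (of_real (1 + x\<^sup>2)) (mat 1)"
proof -
  have "\<i> * of_real x * (\<i> * of_real x) = - (of_real x * of_real x)"
    by (simp add: complex_eq_iff)
  then have "gcurve g x ** gcurve g (- x) = mat 1 + cscale (of_real (x\<^sup>2)) (mat 1)
      + (cscale (\<i> * of_real x) g + cscale (- (\<i> * of_real x)) g)"
    using assms by (simp add: gcurve_def involution_def matrix_add_ldistrib matrix_add_rdistrib cscale_add power2_eq_square)
  also have "\<dots> = cscale (of_real (1 + x\<^sup>2)) (mat 1)"
    by (simp add: cscale_def vec_eq_iff algebra_simps)
  finally show ?thesis .
qed

lemma ucurve_scale: "of_real (1 / sqrt (1 + x\<^sup>2)) * of_real (1 / sqrt (1 + x\<^sup>2)) = (of_real (1 / (1 + x\<^sup>2)) :: complex)"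
  by (simp flip: of_real_mult of_real_divide)

lemma hadjoint_ucurve:
  "involution g \<Longrightarrow> hadjoint (ucurve g x) = cscale (of_real (1 / sqrt (1 + x\<^sup>2))) (gcurve g (- x))"
  by (simp add: ucurve_def hadjoint_cscale hadjoint_gcurve)

text \<open>The square root enters once from each side, so conjugation along the curve is rational
  in \<open>x\<close>.\<close>

lemma ucurve_conj:
  "involution g \<Longrightarrow> ucurve g x ** P ** hadjoint (ucurve g x)
    = cscale (of_real (1 / (1 + x\<^sup>2))) (gcurve g x ** P ** gcurve g (- x))"
  unfolding hadjoint_ucurve
  by (simp only: ucurve_def cscale_mult cscale_cscale ucurve_scale)

lemma unitary_ucurve:
  assumes "involution g"
  shows "unitary (ucurve g x)"
proof -
  have "1 / (1 + x\<^sup>2) * (1 + x\<^sup>2) = 1"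
    by (simp add: add_nonneg_eq_0_iff)
  then have pos: "(of_real (1 / (1 + x\<^sup>2)) * of_real (1 + x\<^sup>2) :: complex) = 1"
    unfolding of_real_mult[symmetric] by (simp only: of_real_1)
  show ?thesis
    unfolding unitary_def hadjoint_ucurve[OF assms]
    using gcurve_mult[OF assms, of x] gcurve_mult[OF assms, of "- x"] pos
    by (simp only: ucurve_def cscale_mult cscale_cscale ucurve_scale mult.assoc[symmetric]
        minus_minus power2_minus cscale_one simp_thms)
qed

text \<open>\<open>g (1 + \<i> x g) = \<i> x (1 - (\<i> / x) g)\<close>, so \<open>g\<close> maps the curve to itself up to a phase.\<close>

lemma involution_ucurve_conj:
  assumes g: "involution g" and x: "x \<noteq> 0"
  shows "g ** (ucurve g x ** P ** hadjoint (ucurve g x)) ** g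
    = ucurve g (- 1 / x) ** P ** hadjoint (ucurve g (- 1 / x))"
proof -
  have 1: "g ** gcurve g x = cscale (\<i> * of_real x) (gcurve g (- 1 / x))"
    using g x by (simp add: gcurve_def involution_def matrix_add_ldistrib cscale_add add.commute)
  have "gcurve g (- x) ** g = hadjoint (g ** gcurve g x)"
    using g by (simp add: hadjoint_mult hadjoint_gcurve) (simp add: involution_def)
  also have "\<dots> = cscale (- \<i> * of_real x) (gcurve g (1 / x))"
    using g unfolding 1 by (simp add: hadjoint_cscale hadjoint_gcurve)
  finally have 2: "gcurve g (- x) ** g = cscale (- \<i> * of_real x) (gcurve g (1 / x))" .
  have "1 / (1 + x\<^sup>2) * x\<^sup>2 = 1 / (1 + (- 1 / x)\<^sup>2)"
    using x by (simp add: field_simps power2_eq_square)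
  moreover have i: "\<i> * of_real x * (- \<i> * of_real x) = of_real (x\<^sup>2)"
    by (simp add: complex_eq_iff power2_eq_square)
  ultimately have c: "of_real (1 / (1 + x\<^sup>2)) * (\<i> * of_real x * (- \<i> * of_real x)) = (of_real (1 / (1 + (- 1 / x)\<^sup>2)) :: complex)"
    unfolding i of_real_mult[symmetric] by (simp only:)
  have "g ** (ucurve g x ** P ** hadjoint (ucurve g x)) ** g
      = cscale (of_real (1 / (1 + x\<^sup>2))) ((g ** gcurve g x) ** P ** (gcurve g (- x) ** g))"
    unfolding ucurve_conj[OF g] by (simp add: matrix_mul_assoc)
  also have "\<dots> = cscale (of_real (1 / (1 + x\<^sup>2)) * (\<i> * of_real x * (- \<i> * of_real x)))
      (gcurve g (- 1 / x) ** P ** gcurve g (1 / x))"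
    unfolding 1 2 by (simp only: cscale_mult cscale_cscale mult.commute mult.left_commute)
  finally show ?thesis
    unfolding c ucurve_conj[OF g] by simp
qed

text \<open>Off the zeros of a polynomial, the kernel dimension takes its minimum over the whole
  curve. Conjugation by \<open>g\<close> only moves to the point \<open>- 1 / x\<close> of the same
  curve, so it cannot go lower.\<close>

lemma finite_dim_kernel_increase:
  fixes e :: "'k::finite \<Rightarrow> 'v::finite" and g P :: "complex ^ ('k \<Rightarrow> bool) ^ ('k \<Rightarrow> bool)"
  assumes g: "involution g" and P: "hadjoint P = P" and A: "hadjoint A = A"
  defines "T \<equiv> \<lambda>x. ucurve g x ** P ** hadjoint (ucurve g x)"
  shows "finite {x. x \<noteq> 0 \<and> vec.dim (matrix_kernel (A + on_qubits e (g ** T x ** g)))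
    < vec.dim (matrix_kernel (A + on_qubits e (T x)))}"
proof -
  define F where "F x = vec.dim (matrix_kernel (A + on_qubits e (T x)))" for x
  \<comment> \<open>A minimum of natural numbers is attained; \<open>undefined\<close> is just some
    real showing that the domain is nonempty.\<close>
  obtain x0 where x0: "\<And>x. F x0 \<le> F x"
    using ex_has_least_nat[of "\<lambda>_. True" undefined F] by auto
  obtain K where K: "is_orth_proj K (matrix_kernel (A + on_qubits e (T x0)))"
    using is_orth_proj_exists subspace_matrix_kernel by blast
  have "hadjoint (T x0) = T x0"
    by (simp add: T_def hadjoint_mult P matrix_mul_assoc)
  then have det0: "det (A + on_qubits e (T x0) + K) \<noteq> 0"
    by (intro det_add_kernel_projector K) (simp add: hadjoint_add A hadjoint_on_qubits)
  \<comment> \<open>The matrix \<open>A + on_qubits e (T x) + K\<close> is multiplied by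
    \<open>1 + x\<^sup>2\<close> to clear the denominator, which makes the determinant a polynomial
    in \<open>x\<close>.\<close>
  define f where "f x = det (cscale (of_real (1 + x\<^sup>2)) (A + K) + on_qubits e (gcurve g x ** P ** gcurve g (- x)))" for x
  have f_eq: "f x \<noteq> 0 \<longleftrightarrow> det (A + on_qubits e (T x) + K) \<noteq> 0" for x
  proof -
    have nz: "1 + x\<^sup>2 \<noteq> 0"
      by (simp add: add_nonneg_eq_0_iff)
    then have nz': "complex_of_real (1 + x\<^sup>2) \<noteq> 0"
      by (simp only: of_real_eq_0_iff not_False_eq_True)
    have one: "complex_of_real (1 + x\<^sup>2) * of_real (1 / (1 + x\<^sup>2)) = 1"
      unfolding of_real_mult[symmetric] using nz by simp
    have "cscale (of_real (1 + x\<^sup>2)) (A + on_qubits e (T x) + K)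
        = cscale (of_real (1 + x\<^sup>2)) (A + K) + on_qubits e (gcurve g x ** P ** gcurve g (- x))"
      unfolding T_def ucurve_conj[OF g] on_qubits_cscale cscale_add cscale_cscale one cscale_one
      by (simp only: add_ac)
    then show ?thesis
      using det_cscale_nz[OF nz', of "A + on_qubits e (T x) + K"] by (simp only: f_def)
  qed
  have curve: "poly_matrix (gcurve g)" "poly_matrix (\<lambda>x. gcurve g (- x))"
  proof -
    have "poly_fun (\<lambda>x. \<i> * of_real x)" "poly_fun (\<lambda>x. - \<i> * of_real x)"
      by (intro poly_fun_intros)+
    then show "poly_matrix (gcurve g)" "poly_matrix (\<lambda>x. gcurve g (- x))"
      unfolding gcurve_def
      by (simp_all add: poly_matrix_add poly_matrix_const poly_matrix_cscale)
  qed
  have "poly_fun (\<lambda>x. 1 + of_real x * of_real x)"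
    by (intro poly_fun_intros)
  then have "poly_fun (\<lambda>x. of_real (1 + x\<^sup>2))"
    by (simp add: power2_eq_square)
  then have "poly_fun f"
    unfolding f_def
    by (intro poly_fun_det poly_matrix_add poly_matrix_const poly_matrix_cscale poly_matrix_on_qubits
        poly_matrix_mult curve)
  then have "finite {x. f x = 0}"
    using poly_fun_finite_zeros[of f x0] f_eq[of x0] det0 by simp
  moreover have "f x = 0" if x: "x \<noteq> 0" and less: "vec.dim (matrix_kernel (A + on_qubits e (g ** T x ** g))) < F x" for x
  proof (rule ccontr)
    assume "f x \<noteq> 0"
    then have "F x \<le> vec.dim (range ((*v) K))"
      unfolding F_def by (intro dim_kernel_le_of_det) (use f_eq[of x] in blast)
    also have "\<dots> = F x0"
      using K by (simp add: is_orth_proj_def F_def)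
    also have "F x0 \<le> F (- 1 / x)"
      by (rule x0)
    also have "\<dots> = vec.dim (matrix_kernel (A + on_qubits e (g ** T x ** g)))"
      unfolding F_def T_def involution_ucurve_conj[OF g x] ..
    finally show False
      using less by simp
  qed
  ultimately show ?thesis
    unfolding F_def[symmetric] by (auto elim: rev_finite_subset)
qed

section \<open>Generic subspaces\<close>

lemma continuous_on_matrix_mult:
  fixes f :: "'a::topological_space \<Rightarrow> complex ^ 'n ^ 'm" and h :: "'a \<Rightarrow> complex ^ 'p ^ 'n"
  shows "continuous_on S f \<Longrightarrow> continuous_on S h \<Longrightarrow> continuous_on S (\<lambda>x. f x ** h x)"
  unfolding matrix_matrix_mult_def by (intro continuous_intros)

lemma measurable_orth_proj [measurable]: "orth_proj \<in> measurable (Gr_borel r) borel"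
  unfolding Gr_borel_def by (rule measurable_vimage_algebra1) simp

lemma space_Gr_borel [simp]: "space (Gr_borel r) = Gr r"
  by (simp add: Gr_borel_def)

lemma orth_proj_unitary_image:
  "unitary U \<Longrightarrow> S \<in> Gr r \<Longrightarrow> orth_proj ((*v) U ` S) = U ** orth_proj S ** hadjoint U"
  by (intro orth_proj_eq is_orth_proj_unitary_image is_orth_proj_orth_proj) (auto simp: Gr_def)

lemma unitary_image_Gr:
  assumes U: "unitary U" and S: "S \<in> Gr r"
  shows "(*v) U ` S \<in> Gr r"
proof -
  have "inj ((*v) U)"
    by (rule inj_on_inverseI[of _ "(*v) (hadjoint U)"])
       (use U in \<open>simp add: matrix_vector_mul_assoc unitary_def\<close>)
  then have "vec.dim ((*v) U ` S) = vec.dim S"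
    by (intro vec.dim_image_eq) (auto intro: inj_on_subset)
  moreover have "vec.subspace ((*v) U ` S)"
    using S by (intro vec.subspace_image) (auto simp: Gr_def)
  ultimately show ?thesis
    using S by (simp add: Gr_def)
qed

text \<open>The sigma-algebra is pulled back along \<open>orth_proj\<close>, where the action
  becomes the continuous map \<open>U ** P ** hadjoint U\<close>.\<close>

lemma measurable_unitary_image:
  assumes U: "unitary U"
  shows "(\<lambda>S. (*v) U ` S) \<in> measurable (Gr_borel r) (Gr_borel r)"
proof -
  have "(\<lambda>P. U ** P ** hadjoint U) \<in> borel_measurable borel"
    by (intro borel_measurable_continuous_onI continuous_on_matrix_mult continuous_intros)
  then have "(\<lambda>S. U ** orth_proj S ** hadjoint U) \<in> measurable (Gr_borel r) borel"
    by (rule measurable_compose[OF measurable_orth_proj])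
  then have "(\<lambda>S. orth_proj ((*v) U ` S)) \<in> measurable (Gr_borel r) borel"
    by (rule measurable_cong[THEN iffD1, rotated]) (simp add: orth_proj_unitary_image[OF U])
  then show ?thesis
    unfolding Gr_borel_def[of r]
    by (intro measurable_vimage_algebra2) (auto simp: unitary_image_Gr[OF U] simp flip: Gr_borel_def)
qed

lemma borel_measurable_on_qubits [measurable]: "on_qubits e \<in> borel_measurable borel"
proof -
  have "continuous_on UNIV (\<lambda>A. if b then A $ s $ t else (0::complex))" for b s t
    by (cases b) (simp_all, intro continuous_intros)
  then show ?thesis
    unfolding on_qubits_def
    by (intro borel_measurable_continuous_onI continuous_on_vec_lambda)
qed

lemma AE_dim_kernel_le_involution:
  fixes e :: "'k::finite \<Rightarrow> 'v::finite"
  assumes \<mu>: "is_Haar_Gr r \<mu>" and g: "involution g" and A: "hadjoint A = A"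
  shows "AE S in \<mu>. vec.dim (matrix_kernel (A + on_qubits e (orth_proj S)))
    \<le> vec.dim (matrix_kernel (A + on_qubits e (orth_proj ((*v) g ` S))))"
proof -
  interpret prob_space \<mu>
    using \<mu> by (simp add: is_Haar_Gr_def)
  have sets: "sets \<mu> = sets (Gr_borel r)"
    using \<mu> by (simp add: is_Haar_Gr_def)
  have space: "space \<mu> = Gr r"
    using sets_eq_imp_space_eq[OF sets] by simp
  have meas_iff: "measurable \<mu> X = measurable (Gr_borel r) X" for X :: "'x measure"
    by (rule measurable_cong_sets[OF sets refl])
  define F where "F S = real (vec.dim (matrix_kernel (A + on_qubits e (orth_proj S))))" for S
  have F: "F \<in> borel_measurable (Gr_borel r)"
    unfolding F_def by measurable
  have Fg: "(\<lambda>S. F ((*v) g ` S)) \<in> borel_measurable (Gr_borel r)"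
    by (rule measurable_compose[OF measurable_unitary_image[OF involution_unitary[OF g]] F])
  define B where "B = {S \<in> space \<mu>. F ((*v) g ` S) < F S}"
  have B: "B \<in> sets \<mu>"
    unfolding B_def using F Fg by (intro borel_measurable_less) (simp_all add: meas_iff)
  \<comment> \<open>\<open>Suc j\<close> keeps the parameter away from 0, which has no partner
    \<open>- 1 / x\<close>.\<close>
  define h where "h j S = (*v) (ucurve g (real (Suc j))) ` S" for j S
  have h: "h j \<in> measurable \<mu> \<mu>" for j
    unfolding h_def meas_iff measurable_cong_sets[OF refl sets]
    by (rule measurable_unitary_image[OF unitary_ucurve[OF g]])
  define D where "D j = (\<Union>i\<in>{j..}. h i -` B \<inter> space \<mu>)" for j
  have pre: "h j -` B \<inter> space \<mu> \<in> events" for j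
    using h B by (rule measurable_sets)
  have D: "D j \<in> events" for j
    unfolding D_def using pre by (intro sets.countable_UN'') auto
  have "prob B \<le> prob (D j)" for j
  proof -
    have "distr \<mu> (Gr_borel r) (h j) = \<mu>"
      unfolding h_def using \<mu> unitary_ucurve[OF g] by (auto simp: is_Haar_Gr_def)
    moreover have "measure (distr \<mu> (Gr_borel r) (h j)) B = prob (h j -` B \<inter> space \<mu>)"
      using h B by (intro measure_distr) (simp_all add: sets measurable_cong_sets[OF refl sets])
    ultimately have "prob B = prob (h j -` B \<inter> space \<mu>)"
      by simp
    also have "\<dots> \<le> prob (D j)"
      by (intro finite_measure_mono D) (auto simp: D_def)
    finally show ?thesis .
  qed
  moreover have "(\<lambda>j. prob (D j)) \<longlonglongrightarrow> 0"
  proof -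
    have "(\<Inter>j. D j) = {}"
    proof safe
      fix S assume S: "S \<in> (\<Inter>j. D j)"
      then have SGr: "S \<in> Gr r"
        by (auto simp: D_def space)
      then have P: "is_orth_proj (orth_proj S) S"
        by (intro is_orth_proj_orth_proj) (simp add: Gr_def)
      define T where "T x = ucurve g x ** orth_proj S ** hadjoint (ucurve g x)" for x
      let ?Z = "{x. x \<noteq> 0 \<and> vec.dim (matrix_kernel (A + on_qubits e (g ** T x ** g)))
          < vec.dim (matrix_kernel (A + on_qubits e (T x)))}"
      have "finite ?Z"
        unfolding T_def using P by (intro finite_dim_kernel_increase g A) (simp add: is_orth_proj_def)
      then have "finite ((\<lambda>j. real (Suc j)) -` ?Z)"
        by (rule finite_vimageI) (simp add: inj_on_def)
      \<comment> \<open>If \<open>h i S\<close> is in \<open>B\<close>, conjugation by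
        \<open>g\<close> strictly lowers the kernel dimension at the curve point
        \<open>Suc i\<close>.\<close>
      moreover have "{i. h i S \<in> B} \<subseteq> (\<lambda>j. real (Suc j)) -` ?Z"
      proof (rule subsetI)
        fix i assume "i \<in> {i. h i S \<in> B}"
        then have less: "F ((*v) g ` h i S) < F (h i S)"
          by (simp add: B_def)
        have hGr: "h i S \<in> Gr r"
          unfolding h_def by (rule unitary_image_Gr[OF unitary_ucurve[OF g] SGr])
        have hT: "orth_proj (h i S) = T (real (Suc i))"
          unfolding h_def T_def by (rule orth_proj_unitary_image[OF unitary_ucurve[OF g] SGr])
        have "orth_proj ((*v) g ` h i S) = g ** T (real (Suc i)) ** g"
          using orth_proj_unitary_image[OF involution_unitary[OF g] hGr] g by (simp add: hT involution_def)
        then show "i \<in> (\<lambda>j. real (Suc j)) -` ?Z"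
          using less by (simp add: F_def hT)
      qed
      ultimately have "finite {i. h i S \<in> B}"
        by (rule finite_subset[rotated])
      then obtain j where "\<And>i. h i S \<in> B \<Longrightarrow> i < j"
        using finite_nat_set_iff_bounded by auto
      moreover have "S \<in> D j"
        using S by blast
      ultimately show "S \<in> {}"
        by (fastforce simp: D_def)
    qed
    moreover have "decseq D"
      unfolding D_def decseq_def by (intro allI impI UN_mono) auto
    ultimately show ?thesis
      using finite_Lim_measure_decseq[of D] D by auto
  qed
  ultimately have "prob B \<le> 0"
    by (intro LIMSEQ_le_const) auto
  then have "emeasure \<mu> B = 0"
    by (simp add: emeasure_eq_measure measure_le_0_iff)
  then have "AE S in \<mu>. F S \<le> F ((*v) g ` S)"
    by (intro AE_I[of _ _ B]) (auto simp: B_def B[unfolded B_def])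
  then show ?thesis
    by (simp add: F_def)
qed

text \<open>Pairing with \<open>x\<close> gives the sum of the squared norms of
  \<open>A *v x\<close> and \<open>B *v x\<close>, so both vanish.\<close>

lemma matrix_kernel_add_hadjoint_mult:
  "matrix_kernel (hadjoint A ** A + hadjoint B ** B) = matrix_kernel A \<inter> matrix_kernel B"
proof -
  have "A *v x = 0 \<and> B *v x = 0" if "(hadjoint A ** A + hadjoint B ** B) *v x = 0" for x
  proof -
    have "x \<bullet> ((hadjoint A ** A + hadjoint B ** B) *v x) = (A *v x) \<bullet> (A *v x) + (B *v x) \<bullet> (B *v x)"
      by (simp only: matrix_vector_mult_add_rdistrib inner_add_right matrix_vector_mul_assoc[symmetric]
          inner_hadjoint[of x "hadjoint _"] hadjoint_hadjoint)
    then show ?thesis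
      using that by (simp add: add_nonneg_eq_0_iff)
  qed
  then show ?thesis
    by (auto simp: matrix_kernel_def matrix_vector_mult_add_rdistrib simp flip: matrix_vector_mul_assoc)
qed

lemma on_qubits_orth_proj:
  "inj e \<Longrightarrow> is_orth_proj P S \<Longrightarrow> hadjoint (on_qubits e P) ** on_qubits e P = on_qubits e P"
  by (simp add: hadjoint_on_qubits on_qubits_mult is_orth_proj_def)

text \<open>The projector \<open>on_qubits e P\<close> is its own \<open>hadjoint B ** B\<close>,
  while \<open>hadjoint A ** A\<close> provides positivity for arbitrary \<open>A\<close>.\<close>

lemma matrix_kernel_add_on_qubits:
  "inj e \<Longrightarrow> is_orth_proj P S \<Longrightarrow>
    matrix_kernel (hadjoint A ** A + on_qubits e P) = matrix_kernel A \<inter> matrix_kernel (on_qubits e P)"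
  using matrix_kernel_add_hadjoint_mult[of A "on_qubits e P"] by (simp add: on_qubits_orth_proj)

text \<open>There are finitely many conjugates, so almost surely \<open>S\<close> leaves no larger
  kernel than any of them; one of them, depending on \<open>S\<close>, meets the bound.\<close>

lemma AE_dim_kernel_le:
  fixes e :: "'k::finite \<Rightarrow> 'v::finite"
  assumes \<mu>: "is_Haar_Gr r \<mu>" and e: "inj e"
  shows "AE S in \<mu>. real (vec.dim (matrix_kernel (hadjoint A ** A + on_qubits e (orth_proj S))))
    \<le> (1 - real r / 2 ^ CARD('k)) * real (vec.dim (matrix_kernel A))"
proof -
  define F where "F S = vec.dim (matrix_kernel (hadjoint A ** A + on_qubits e (orth_proj S)))" for S
  have sets: "sets \<mu> = sets (Gr_borel r)"
    using \<mu> by (simp add: is_Haar_Gr_def)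
  have space: "space \<mu> = Gr r"
    using sets_eq_imp_space_eq[OF sets] by simp
  have inv: "AE S in \<mu>. F S \<le> F ((*v) g ` S)" if "involution g" for g
    unfolding F_def by (rule AE_dim_kernel_le_involution[OF \<mu> that]) (simp add: hadjoint_mult)
  have "AE S in \<mu>. F S \<le> F ((*v) (flips a) ` (*v) (signs \<epsilon>) ` S)" for a \<epsilon>
  proof -
    have U: "unitary (signs \<epsilon>)"
      by (simp add: involution_signs involution_unitary)
    have distr: "distr \<mu> (Gr_borel r) (\<lambda>S. (*v) (signs \<epsilon>) ` S) = \<mu>"
      using \<mu> U by (simp add: is_Haar_Gr_def)
    \<comment> \<open>The flip comparison is made at the image of \<open>S\<close> under
      \<open>signs \<epsilon>\<close>, which is again Haar distributed; its null set is pulled back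
      to \<open>S\<close>.\<close>
    have "AE S in distr \<mu> (Gr_borel r) (\<lambda>S. (*v) (signs \<epsilon>) ` S). F S \<le> F ((*v) (flips a) ` S)"
      unfolding distr by (rule inv[OF involution_flips])
    then have "AE S in \<mu>. F ((*v) (signs \<epsilon>) ` S) \<le> F ((*v) (flips a) ` (*v) (signs \<epsilon>) ` S)"
      by (rule AE_distrD[rotated])
         (use measurable_unitary_image[OF U] in \<open>simp add: measurable_cong_sets[OF sets refl]\<close>)
    with inv[OF involution_signs[of \<epsilon>]] show ?thesis
      by eventually_elim simp
  qed
  then have "AE S in \<mu>. \<forall>a \<epsilon>. F S \<le> F ((*v) (flips a) ` (*v) (signs \<epsilon>) ` S)"
    by (simp add: eventually_all_finite)
  with AE_space show ?thesis
  proof eventually_elim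
    fix S assume "S \<in> space \<mu>" and le: "\<forall>a \<epsilon>. F S \<le> F ((*v) (flips a) ` (*v) (signs \<epsilon>) ` S)"
    then have "vec.subspace S" and dim: "vec.dim S = r"
      by (auto simp: space Gr_def)
    then have P: "is_orth_proj (orth_proj S) S"
      by (intro is_orth_proj_orth_proj)
    let ?T = "\<lambda>a \<epsilon>. flips a ** (signs \<epsilon> ** orth_proj S ** signs \<epsilon>) ** flips a"
    note T = is_orth_proj_flips_signs[OF P]
    obtain a \<epsilon> where *: "real (vec.dim (matrix_kernel A \<inter> matrix_kernel (on_qubits e (?T a \<epsilon>))))
        \<le> (1 - real (vec.dim S) / 2 ^ CARD('k)) * real (vec.dim (matrix_kernel A))"
      using exists_flips_signs_dim_le[OF e P subspace_matrix_kernel] by blast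
    have "F ((*v) (flips a) ` (*v) (signs \<epsilon>) ` S) = vec.dim (matrix_kernel A \<inter> matrix_kernel (on_qubits e (?T a \<epsilon>)))"
      unfolding F_def orth_proj_eq[OF T] matrix_kernel_add_on_qubits[OF e T] ..
    then show "real (vec.dim (matrix_kernel (hadjoint A ** A + on_qubits e (orth_proj S))))
        \<le> (1 - real r / 2 ^ CARD('k)) * real (vec.dim (matrix_kernel A))"
      using * le[rule_format, of a \<epsilon>] by (simp add: F_def dim)
  qed
qed

section \<open>All clauses together\<close>

text \<open>Pairing with \<open>x\<close> turns the sum into squared norms, each of which must
  vanish.\<close>

lemma matrix_kernel_sum_hadjoint_mult:
  assumes "finite J"
  shows "matrix_kernel (\<Sum>i\<in>J. hadjoint (B i) ** B i) = (\<Inter>i\<in>J. matrix_kernel (B i))"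
proof -
  have sum: "(\<Sum>i\<in>J. C i) *v x = (\<Sum>i\<in>J. C i *v x)" for C :: "'a \<Rightarrow> complex ^ 'b ^ 'b" and x
    by (induction J rule: infinite_finite_induct) (simp_all add: matrix_vector_mult_add_rdistrib)
  have "B i *v x = 0" if x: "(\<Sum>i\<in>J. hadjoint (B i) ** B i) *v x = 0" and i: "i \<in> J" for x i
  proof -
    have "x \<bullet> ((hadjoint (B j) ** B j) *v x) = (B j *v x) \<bullet> (B j *v x)" for j
      by (simp only: matrix_vector_mul_assoc[symmetric] inner_hadjoint[of x "hadjoint _"] hadjoint_hadjoint)
    then have "(\<Sum>j\<in>J. (B j *v x) \<bullet> (B j *v x)) = x \<bullet> ((\<Sum>i\<in>J. hadjoint (B i) ** B i) *v x)"
      by (simp add: sum inner_sum_right)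
    then have "(\<Sum>j\<in>J. (B j *v x) \<bullet> (B j *v x)) = 0"
      by (simp add: x)
    then show ?thesis
      using i assms by (simp add: sum_nonneg_eq_0_iff)
  qed
  then show ?thesis
    by (auto simp: matrix_kernel_def sum simp flip: matrix_vector_mul_assoc)
qed

theorem mainTheorem2:
  fixes k r N M :: nat
    and I :: "nat \<Rightarrow> 'v::finite set"
    and e :: "nat \<Rightarrow> 'k::finite \<Rightarrow> 'v"
    and P :: "'w measure"
    and W :: "nat \<Rightarrow> 'w \<Rightarrow> (complex ^ ('k \<Rightarrow> bool)) set"
  assumes "k \<ge> 1" and "1 \<le> r" and "r \<le> 2 ^ k"
    and "CARD('k) = k" and "CARD('v) = N"
    and "uniform_hypergraph k M I"
    and "edge_enumeration M I e"
    and "random_qsat P r M W"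
  shows "AE \<omega> in P.
    real (vec.dim (matrix_kernel (qsat_hamiltonian M e (\<lambda>m. W m \<omega>))))
      \<le> 2 ^ N * (1 - real r / 2 ^ k) ^ M"
proof -
  interpret prob_space P
    using assms(8) by (simp add: random_qsat_def)
  have indep: "indep_vars (\<lambda>_. Gr_borel r) W {1..M}"
    and Haar: "\<And>m. m \<in> {1..M} \<Longrightarrow> is_Haar_Gr r (distr P (Gr_borel r) (W m))"
    using assms(8) by (auto simp: random_qsat_def)
  have W: "random_variable (Gr_borel r) (W m)" if "m \<in> {1..M}" for m
    using indep that by (simp add: indep_vars_def)
  have inj: "inj (e m)" if "m \<in> {1..M}" for m
    using assms(7) that by (auto simp: edge_enumeration_def bij_betw_def)
  define c where "c = 1 - real r / 2 ^ k"
  \<comment> \<open>Nonnegativity of \<open>c\<close> lets the bound be multiplied by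
    \<open>c\<close> in the induction.\<close>
  have "real r \<le> 2 ^ k"
    using assms(3) by (metis of_nat_le_iff of_nat_numeral of_nat_power)
  then have c: "c \<ge> 0"
    by (simp add: c_def)
  define X where "X m \<omega> = qsat_hamiltonian m e (\<lambda>m. W m \<omega>)" for m \<omega>
  define d where "d A = real (vec.dim (matrix_kernel A))" for A :: "complex ^ ('v \<Rightarrow> bool) ^ ('v \<Rightarrow> bool)"
  have d_meas: "d \<in> borel_measurable borel"
    unfolding d_def by measurable
  \<comment> \<open>One more clause costs a factor \<open>c\<close>: the first \<open>m\<close>
    subspaces are frozen, the bound for a single random clause is applied, and the product measure
    joins the two.\<close>
  have step: "AE \<omega> in P. d (X (Suc m) \<omega>) \<le> c * d (X m \<omega>)" if m: "Suc m \<le> M" for m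
  proof -
    let ?H = "\<lambda>f. \<Sum>i\<in>{1..m}. on_qubits (e i) (orth_proj (f i))"
    \<comment> \<open>With \<open>hadjoint (?H f) ** ?H f\<close> in place of \<open>?H f\<close>
      the single-clause bound applies to every \<open>f\<close>, since nothing is demanded of the
      matrix.\<close>
    let ?\<phi> = "\<lambda>(f, h). d (hadjoint (?H f) ** ?H f + on_qubits (e (Suc m)) (orth_proj (h (Suc m)))) \<le> c * d (?H f)"
    let ?S1 = "PiM {1..m} (\<lambda>_. Gr_borel r)" and ?S2 = "PiM {Suc m} (\<lambda>_. Gr_borel r)"
    let ?W1 = "\<lambda>\<omega>. restrict (\<lambda>i. W i \<omega>) {1..m}" and ?W2 = "\<lambda>\<omega>. restrict (\<lambda>i. W i \<omega>) {Suc m}"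
    \<comment> \<open>By independence the joint law of the two blocks is a product measure; for
      \<open>m = 0\<close> the first block is empty.\<close>
    have "indep_var ?S1 ?W1 ?S2 ?W2"
      using m by (intro indep_var_restrict[OF indep]) auto
    then have W1: "random_variable ?S1 ?W1" and W2: "random_variable ?S2 ?W2"
      and distr: "distr P ?S1 ?W1 \<Otimes>\<^sub>M distr P ?S2 ?W2 = distr P (?S1 \<Otimes>\<^sub>M ?S2) (\<lambda>\<omega>. (?W1 \<omega>, ?W2 \<omega>))"
      by (simp_all add: indep_var_distribution_eq)
    interpret W1: prob_space "distr P ?S1 ?W1"
      by (rule prob_space_distr[OF W1])
    interpret W2: prob_space "distr P ?S2 ?W2"
      by (rule prob_space_distr[OF W2])
    interpret pair_sigma_finite "distr P ?S1 ?W1" "distr P ?S2 ?W2" ..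
    have H: "?H \<in> borel_measurable ?S1"
    proof (rule borel_measurable_sum)
      fix i assume "i \<in> {1..m}"
      then have "(\<lambda>f. f i) \<in> measurable ?S1 (Gr_borel r)"
        by (rule measurable_component_singleton)
      then show "(\<lambda>f. on_qubits (e i) (orth_proj (f i))) \<in> borel_measurable ?S1"
        by measurable
    qed
    have component: "(\<lambda>h. h (Suc m)) \<in> measurable ?S2 (Gr_borel r)"
      by (rule measurable_component_singleton) simp
    have "(\<lambda>A :: complex ^ ('v \<Rightarrow> bool) ^ ('v \<Rightarrow> bool). hadjoint A ** A) \<in> borel_measurable borel"
      unfolding hadjoint_def by (intro borel_measurable_continuous_onI continuous_on_matrix_mult continuous_intros)
    note [measurable] = this d_meas H component
    have sets: "sets (distr P ?S1 ?W1 \<Otimes>\<^sub>M distr P ?S2 ?W2) = sets (?S1 \<Otimes>\<^sub>M ?S2)"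
      by (intro sets_pair_measure_cong) simp_all
    \<comment> \<open>Measurability of this set allows passing from almost every fibre to almost
      every pair.\<close>
    have "{x \<in> space (?S1 \<Otimes>\<^sub>M ?S2). ?\<phi> x} \<in> sets (?S1 \<Otimes>\<^sub>M ?S2)"
      by measurable
    then have "AE x in distr P ?S1 ?W1 \<Otimes>\<^sub>M distr P ?S2 ?W2. ?\<phi> x"
    proof (intro AE_pair_measure)
      have "AE h in distr P ?S2 ?W2. ?\<phi> (f, h)" for f
      proof -
        have "distr (distr P ?S2 ?W2) (Gr_borel r) (\<lambda>h. h (Suc m)) = distr P (Gr_borel r) (W (Suc m))"
          by (simp add: distr_distr[OF component W2] comp_def)
        moreover have "AE S in distr P (Gr_borel r) (W (Suc m)).
            d (hadjoint (?H f) ** ?H f + on_qubits (e (Suc m)) (orth_proj S)) \<le> c * d (?H f)"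
          unfolding c_def d_def using AE_dim_kernel_le[OF Haar inj, of "Suc m" "Suc m" "?H f"] m assms(4)
          by simp
        ultimately have "AE S in distr (distr P ?S2 ?W2) (Gr_borel r) (\<lambda>h. h (Suc m)).
            d (hadjoint (?H f) ** ?H f + on_qubits (e (Suc m)) (orth_proj S)) \<le> c * d (?H f)"
          by (simp only:)
        then have "AE h in distr P ?S2 ?W2.
            d (hadjoint (?H f) ** ?H f + on_qubits (e (Suc m)) (orth_proj (h (Suc m)))) \<le> c * d (?H f)"
          by (rule AE_distrD[rotated]) (simp add: component)
        then show ?thesis
          by simp
      qed
      then show "AE f in distr P ?S1 ?W1. AE h in distr P ?S2 ?W2. ?\<phi> (f, h)"
        by blast
    qed (simp only: sets sets_eq_imp_space_eq[OF sets])
    then have "AE \<omega> in P. ?\<phi> (?W1 \<omega>, ?W2 \<omega>)"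
      unfolding distr by (rule AE_distrD[rotated]) (intro measurable_Pair W1 W2)
    moreover have "?H (?W1 \<omega>) = X m \<omega>" for \<omega>
      by (simp add: X_def qsat_hamiltonian_def)
    ultimately have "AE \<omega> in P. d (hadjoint (X m \<omega>) ** X m \<omega> + on_qubits (e (Suc m)) (orth_proj (W (Suc m) \<omega>)))
        \<le> c * d (X m \<omega>)"
      by simp
    with AE_space show ?thesis
    proof eventually_elim
      fix \<omega> assume \<omega>: "\<omega> \<in> space P" 
        and le: "d (hadjoint (X m \<omega>) ** X m \<omega> + on_qubits (e (Suc m)) (orth_proj (W (Suc m) \<omega>))) \<le> c * d (X m \<omega>)"
      define B where "B i = on_qubits (e i) (orth_proj (W i \<omega>))" for i
      have proj: "is_orth_proj (orth_proj (W i \<omega>)) (W i \<omega>)" if "i \<in> {1..M}" for i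
        using measurable_space[OF W[OF that] \<omega>] by (intro is_orth_proj_orth_proj) (simp add: Gr_def)
      \<comment> \<open>On actual subspaces every clause is a projector, so each partial Hamiltonian
        has the common kernel of its clauses. This relates \<open>X (Suc m)\<close> to the sum
        bounded above.\<close>
      have ker: "matrix_kernel (X n \<omega>) = (\<Inter>i\<in>{1..n}. matrix_kernel (B i))" if "n \<le> M" for n
      proof -
        have "X n \<omega> = (\<Sum>i\<in>{1..n}. hadjoint (B i) ** B i)"
          unfolding X_def qsat_hamiltonian_def B_def using that
          by (intro sum.cong refl on_qubits_orth_proj[OF inj proj, symmetric]) auto
        then show ?thesis
          by (simp add: matrix_kernel_sum_hadjoint_mult)
      qed
      have "matrix_kernel (X (Suc m) \<omega>) = matrix_kernel (X m \<omega>) \<inter> matrix_kernel (B (Suc m))"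
        using m by (simp add: ker atLeastAtMostSuc_conv Int_commute)
      also have "\<dots> = matrix_kernel (hadjoint (X m \<omega>) ** X m \<omega> + B (Suc m))"
        unfolding B_def using m by (intro matrix_kernel_add_on_qubits[OF inj proj, symmetric]) auto
      finally show "d (X (Suc m) \<omega>) \<le> c * d (X m \<omega>)"
        using le by (simp add: d_def B_def)
    qed
  qed
  have "m \<le> M \<Longrightarrow> AE \<omega> in P. d (X m \<omega>) \<le> 2 ^ N * c ^ m" for m
  proof (induction m)
    case 0
    \<comment> \<open>Without clauses the Hamiltonian is 0 and its kernel is the full space, of
      dimension \<open>2 ^ N\<close>.\<close>
    have "matrix_kernel (X 0 \<omega>) = UNIV" for \<omega>
      by (simp add: X_def qsat_hamiltonian_def matrix_kernel_def)
    then show ?case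
      by (simp add: d_def card_cart_basis card_fun assms(5))
  next
    case (Suc m)
    then have "AE \<omega> in P. d (X m \<omega>) \<le> 2 ^ N * c ^ m"
      by simp
    with step[OF Suc.prems] show ?case
    proof eventually_elim
      case (elim \<omega>)
      then show ?case
        using mult_left_mono[OF elim(2) c] by (simp add: mult_ac)
    qed
  qed
  then show ?thesis
    by (simp add: X_def d_def c_def)
qed

end
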